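(* Let $m\ge 1$ be an integer, let $\ell$ be an odd integer, and let $J$, $A$, $B$, $C$, $s$, $u$, $\phi$, $\varphi$, $\sigma_1,\sigma_2,\sigma_3$ be as defined in the context. Let $a,b,c,n\in\mathbb{Z}$. Then in $J$ $$(A^aB^bC^c)^n=A^{e_A}B^{e_B}C^{e_C}A^{\xi_4},$$ where $$e_A=na+2s\ell\{a^2b\varphi(n)+(\phi(a)b-ac)\phi(n)\},$$ $$e_B=nb+2s\ell\{(b(c-ab)-a\phi(b))\phi(n)-2ab^2\varphi(n)\},$$ $$e_C=nc-ab\phi(n)+2s\ell\{a^2\phi(b)\varphi(n)+\phi(a)\phi(b)\phi(n)-a^2b^2\sigma_2(1,n)-(\phi(a)b-ac)b\varphi(n+1)\},$$ and $$\begin{aligned}\xi_4=2u\ell^2\{&a(\varphi(b)+2\phi(b)-2\phi(c))\phi(n)+a^2(3\varphi(b)-2b\phi(b))(2\varphi(n)+\phi(n))\\&+2a\phi(b)c\varphi(n)-2a^2b\phi(b)(\sigma_1(1,n)-\varphi(n))\\&+(2bc+7\phi(b))(a^2\varphi(n)+\phi(a)\phi(n))\\&-2\phi(b)(a+b)(\sigma_1(a,n)-a\varphi(n))-2b\sigma_2(a,n)\\&+(2\phi(b)-2c-b)(a^2b\sigma_2(1,n)+(\phi(a)b-ac)\varphi(n+1))\\&+2b(a(\phi(a)b-ac)+b^2(\phi(a)-a^2))(\sigma_1(1,n)+\varphi(n+1))\\&+2a^2b^2(a-b)(\sigma_3(n)+\sigma_1(1,n)-\varphi(n))\\&-2c(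(c-ab)b\varphi(n+1)-2ab^2\sigma_2(1,n))\\&+2b(\sigma_1(ab,n)+(\phi(c+1)-abc)\phi(n)-ab(2c+1)\varphi(n))\}.\end{aligned}$$
   Context: Notation: $[a,b]=a^{-1}b^{-1}ab$, $b^a=a^{-1}ba$ for group elements, $\alpha=1+2^m\ell$, $s=2^{m-1}$, $u=s^2$. The group is $$J=\langle A,B\mid A^{[A,B]}=A^{\alpha},\ B^{[B,A]}=B^{\alpha},\ A^{2^{3m-1}}=B^{2^{3m-1}}=1\rangle,\qquad C=[A,B].$$ For $n\in\mathbb{Z}$, $\phi(n)=\frac{(n-1)n}{2}$ and $\varphi(n)=\frac{n(n-1)(n-2)}{6}$. For $k,t\in\mathbb{Z}$, $$\sigma_1(k,t)=\frac{k\phi(t)(k\phi(t)-1)}{2},\qquad \sigma_2(k,t)=\frac{k\phi(t)(k^2\phi(t)-1)}{6},$$ $$\sigma_3(t)=\frac16\left(\frac{(t-1)t\,(6(t-1)^3+9(t-1)^2+t-2)}{30}-3\phi(t)^2+4\varphi(t)+2\phi(t)\right).$$ All these quantities are integers. *)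

theory Defs
  imports "HOL-Algebra.Group"
begin

text \<open>
  A letter \<open>(x, True)\<close> stands for the generator \<open>x\<close> and \<open>(x, False)\<close> for its formal inverse.
  A relation \<open>v = w\<close> is a pair \<open>(v, w)\<close> of words.
\<close>

type_synonym 'g word = "('g \<times> bool) list"

definition word_inv :: "'g word \<Rightarrow> 'g word" where
  "word_inv w = rev (map (\<lambda>(x, b). (x, \<not> b)) w)"

definition word_pow :: "'g word \<Rightarrow> int \<Rightarrow> 'g word" where
  "word_pow w k = (if 0 \<le> k then concat (replicate (nat k) w)
                   else concat (replicate (nat (- k)) (word_inv w)))"

text \<open>The commutator \<open>[v, w] = v\<^sup>-\<^sup>1 w\<^sup>-\<^sup>1 v w\<close> and the conjugate \<open>v\<^sup>w = w\<^sup>-\<^sup>1 v w\<close>.\<close>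

definition word_comm :: "'g word \<Rightarrow> 'g word \<Rightarrow> 'g word" where
  "word_comm v w = word_inv v @ word_inv w @ v @ w"

definition word_conj :: "'g word \<Rightarrow> 'g word \<Rightarrow> 'g word" where
  "word_conj v w = word_inv w @ v @ w"

inductive word_eq :: "('g word \<times> 'g word) set \<Rightarrow> 'g word \<Rightarrow> 'g word \<Rightarrow> bool"
  for R :: "('g word \<times> 'g word) set" where
  rel: "(v, w) \<in> R \<Longrightarrow> word_eq R v w"
| cancel: "word_eq R [(x, b), (x, \<not> b)] []"
| refl: "word_eq R w w"
| sym: "word_eq R v w \<Longrightarrow> word_eq R w v"
| trans: "word_eq R u v \<Longrightarrow> word_eq R v w \<Longrightarrow> word_eq R u w"
| append: "word_eq R v v' \<Longrightarrow> word_eq R w w' \<Longrightarrow> word_eq R (v @ w) (v' @ w')"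

definition word_class :: "('g word \<times> 'g word) set \<Rightarrow> 'g word \<Rightarrow> 'g word set" where
  "word_class R w = {v. word_eq R w v}"

definition presented_group :: "('g word \<times> 'g word) set \<Rightarrow> 'g word set monoid" where
  "presented_group R =
     \<lparr>carrier = range (word_class R),
      mult = (\<lambda>X Y. \<Union>v\<in>X. \<Union>w\<in>Y. word_class R (v @ w)),
      one = word_class R []\<rparr>"

lemma word_class_eq_iff: "word_class R v = word_class R w \<longleftrightarrow> word_eq R v w"
  unfolding word_class_def set_eq_iff mem_Collect_eq
  by (meson word_eq.refl word_eq.sym word_eq.trans)

lemma carrier_presented_group [simp]:
  "carrier (presented_group R) = range (word_class R)"
  by (simp add: presented_group_def)

lemma one_presented_group [simp]:
  "\<one>\<^bsub>presented_group R\<^esub> = word_class R []"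
  by (simp add: presented_group_def)

lemma mult_presented_group [simp]:
  "word_class R v \<otimes>\<^bsub>presented_group R\<^esub> word_class R w = word_class R (v @ w)"
proof -
  have "word_class R (v' @ w') = word_class R (v @ w)"
    if "v' \<in> word_class R v" "w' \<in> word_class R w" for v' w'
  proof -
    have "word_eq R v v'" "word_eq R w w'"
      using that by (simp_all add: word_class_def)
    then show ?thesis
      unfolding word_class_eq_iff by (intro word_eq.sym[OF word_eq.append])
  qed
  moreover have "v \<in> word_class R v" "w \<in> word_class R w"
    by (simp_all add: word_class_def word_eq.refl)
  ultimately have "(\<Union>v'\<in>word_class R v. \<Union>w'\<in>word_class R w. word_class R (v' @ w'))
      = word_class R (v @ w)" by blast
  then show ?thesis
    by (simp add: presented_group_def)
qed

lemma word_inv_append: "word_inv (v @ w) = word_inv w @ word_inv v"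
  by (simp add: word_inv_def)

lemma word_eq_inv_left: "word_eq R (word_inv w @ w) []"
proof (induction w)
  case Nil
  then show ?case by (simp add: word_inv_def word_eq.refl)
next
  case (Cons p w)
  obtain x b where p: "p = (x, b)" by fastforce
  have "word_eq R ([(x, \<not> b), (x, b)] @ w) ([] @ w)"
    using word_eq.cancel[of R x "\<not> b"] by (intro word_eq.append word_eq.refl) simp
  then have "word_eq R (word_inv w @ [(x, \<not> b), (x, b)] @ w) (word_inv w @ w)"
    by (intro word_eq.append word_eq.refl) simp
  then have "word_eq R (word_inv w @ [(x, \<not> b), (x, b)] @ w) []"
    using Cons.IH by (rule word_eq.trans)
  then show ?case by (simp add: p word_inv_def)
qed

lemma group_presented_group: "group (presented_group R)"
proof (rule groupI)
  fix X assume "X \<in> carrier (presented_group R)"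
  then obtain w where X: "X = word_class R w" by auto
  have "word_class R (word_inv w) \<otimes>\<^bsub>presented_group R\<^esub> X = \<one>\<^bsub>presented_group R\<^esub>"
    by (simp add: X word_class_eq_iff word_eq_inv_left)
  then show "\<exists>Y\<in>carrier (presented_group R).
      Y \<otimes>\<^bsub>presented_group R\<^esub> X = \<one>\<^bsub>presented_group R\<^esub>" by auto
qed auto

lemma inv_presented_group:
  "inv\<^bsub>presented_group R\<^esub> (word_class R w) = word_class R (word_inv w)"
  by (rule group.inv_equality[OF group_presented_group])
     (auto simp: word_class_eq_iff word_eq_inv_left)

datatype gen = GenA | GenB

definition alpha :: "nat \<Rightarrow> int \<Rightarrow> int" where
  "alpha m l = 1 + 2 ^ m * l"

definition J_relations :: "nat \<Rightarrow> int \<Rightarrow> (gen word \<times> gen word) set" where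
  "J_relations m l =
    (let A = [(GenA, True)]; B = [(GenB, True)] in
      {(word_conj A (word_comm A B), word_pow A (alpha m l)),
       (word_conj B (word_comm B A), word_pow B (alpha m l)),
       (word_pow A (2 ^ (3 * m - 1)), []),
       (word_pow B (2 ^ (3 * m - 1)), [])})"

definition J :: "nat \<Rightarrow> int \<Rightarrow> gen word set monoid" where
  "J m l = presented_group (J_relations m l)"

definition J_A :: "nat \<Rightarrow> int \<Rightarrow> gen word set" where
  "J_A m l = word_class (J_relations m l) [(GenA, True)]"

definition J_B :: "nat \<Rightarrow> int \<Rightarrow> gen word set" where
  "J_B m l = word_class (J_relations m l) [(GenB, True)]"

definition J_C :: "nat \<Rightarrow> int \<Rightarrow> gen word set" where
  "J_C m l = inv\<^bsub>J m l\<^esub> J_A m l \<otimes>\<^bsub>J m l\<^esub> inv\<^bsub>J m l\<^esub> J_B m l \<otimes>\<^bsub>J m l\<^esub> J_A m l \<otimes>\<^bsub>J m l\<^esub> J_B m l"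

lemma group_J: "group (J m l)"
  by (simp add: J_def group_presented_group)

text \<open>All the divisions below are exact (\<open>two_phi\<close> to \<open>six_sigma3\<close>).\<close>

definition phi :: "int \<Rightarrow> int" where
  "phi n = (n - 1) * n div 2"

definition vphi :: "int \<Rightarrow> int" where
  "vphi n = n * (n - 1) * (n - 2) div 6"

definition sigma1 :: "int \<Rightarrow> int \<Rightarrow> int" where
  "sigma1 k t = k * phi t * (k * phi t - 1) div 2"

definition sigma2 :: "int \<Rightarrow> int \<Rightarrow> int" where
  "sigma2 k t = k * phi t * (k\<^sup>2 * phi t - 1) div 6"

definition sigma3 :: "int \<Rightarrow> int" where
  "sigma3 t =
    ((t - 1) * t * (6 * (t - 1) ^ 3 + 9 * (t - 1)\<^sup>2 + t - 2) div 30
      - 3 * (phi t)\<^sup>2 + 4 * vphi t + 2 * phi t) div 6"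

lemma two_phi: "2 * phi n = (n - 1) * n"
  by (simp add: phi_def)

lemma dvd_of_step:
  fixes f g :: "int \<Rightarrow> int"
  assumes "f 0 = 0" and "\<And>t. f (t + 1) = f t + d * g t"
  shows "d dvd f t"
proof (induction t rule: int_induct[where k = 0])
  case base
  show ?case using assms(1) by simp
next
  case (step1 t)
  then show ?case using assms(2)[of t] by simp
next
  case (step2 t)
  have "f t = f (t - 1) + d * g (t - 1)" using assms(2)[of "t - 1"] by simp
  with step2 show ?case by (simp add: dvd_add_left_iff)
qed

lemma six_vphi: "6 * vphi n = n * (n - 1) * (n - 2)"
proof -
  have "6 dvd n * (n - 1) * (n - 2)"
  proof (rule dvd_of_step[where f = "\<lambda>n. n * (n - 1) * (n - 2)" and g = phi])
    fix t :: int
    have "6 * phi t = 3 * ((t - 1) * t)" using two_phi[of t] by simp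
    then show "(t + 1) * ((t + 1) - 1) * ((t + 1) - 2) = t * (t - 1) * (t - 2) + 6 * phi t"
      by (simp add: algebra_simps)
  qed simp
  then show ?thesis by (simp add: vphi_def)
qed

lemma two_sigma1: "2 * sigma1 k t = k * phi t * (k * phi t - 1)"
proof -
  have "even (x * (x - 1))" for x :: int by simp
  then show ?thesis unfolding sigma1_def by (rule dvd_mult_div_cancel)
qed

lemma six_sigma2: "6 * sigma2 k t = k * phi t * (k\<^sup>2 * phi t - 1)"
proof -
  have "4 * (phi t * (phi t - 1)) = (2 * phi t) * (2 * phi t - 2)"
    by (simp add: algebra_simps)
  also have "\<dots> = (t * (t - 1) * (t - 2)) * (t + 1)"
    unfolding two_phi by (simp add: algebra_simps)
  also have "\<dots> = 6 * (vphi t * (t + 1))"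
    unfolding six_vphi[symmetric] by simp
  finally have "4 * (phi t * (phi t - 1)) = 6 * (vphi t * (t + 1))" .
  moreover have "even (phi t * (phi t - 1))" by simp
  moreover have "6 dvd x" if "4 * x = 6 * y" "even x" for x y :: int
    using that by presburger
  ultimately have "6 dvd phi t * (phi t - 1)" by blast
  then have "6 dvd k ^ 3 * (phi t * (phi t - 1)) + phi t * (6 * vphi (k + 1))"
    by (rule dvd_add[OF dvd_mult dvd_mult[OF dvd_triv_left]])
  moreover have "k * phi t * (k\<^sup>2 * phi t - 1)
      = k ^ 3 * (phi t * (phi t - 1)) + phi t * (6 * vphi (k + 1))"
    unfolding six_vphi by (simp add: algebra_simps power2_eq_square power3_eq_cube)
  ultimately have "6 dvd k * phi t * (k\<^sup>2 * phi t - 1)" by (simp only:)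
  then show ?thesis unfolding sigma2_def by (rule dvd_mult_div_cancel)
qed

lemma thirty_dvd_sigma3_inner:
  "30 dvd (t - 1) * t * (6 * (t - 1) ^ 3 + 9 * (t - 1)\<^sup>2 + t - (2 :: int))"
  by (rule dvd_of_step[where g = "\<lambda>t. t ^ 4"])
     (simp_all add: algebra_simps eval_nat_numeral)

lemma six_sigma3:
  "6 * sigma3 t =
    (t - 1) * t * (6 * (t - 1) ^ 3 + 9 * (t - 1)\<^sup>2 + t - 2) div 30
      - 3 * (phi t)\<^sup>2 + 4 * vphi t + 2 * phi t"
proof -
  define P where "P = (\<lambda>t :: int. (t - 1) * t * (6 * (t - 1) ^ 3 + 9 * (t - 1)\<^sup>2 + t - 2))"
  have "6 dvd P t div 30 - 3 * (phi t)\<^sup>2 + 4 * vphi t + 2 * phi t"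
  proof (rule dvd_of_step[where f = "\<lambda>t. P t div 30 - 3 * (phi t)\<^sup>2 + 4 * vphi t + 2 * phi t"
        and g = "\<lambda>t. (t\<^sup>2 * ((t - 1) * (t - 2))) div 6"])
    fix t :: int
    have P: "30 * (P t div 30) = P t" for t
      using thirty_dvd_sigma3_inner[of t] by (simp add: P_def)
    have "P (t + 1) = P t + 30 * t ^ 4"
      by (simp add: P_def algebra_simps eval_nat_numeral)
    then have 1: "P (t + 1) div 30 = P t div 30 + t ^ 4" by simp
    have p: "phi (t + 1) = phi t + t"
      using two_phi[of "t + 1"] two_phi[of t] by (simp add: algebra_simps)
    have "(phi (t + 1))\<^sup>2 = (phi t)\<^sup>2 + t * (2 * phi t) + t\<^sup>2"
      unfolding p by (simp add: algebra_simps power2_eq_square)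
    then have 2: "(phi (t + 1))\<^sup>2 = (phi t)\<^sup>2 + t ^ 3"
      by (simp only: two_phi) (simp add: algebra_simps eval_nat_numeral)
    have 3: "vphi (t + 1) = vphi t + phi t"
      using six_vphi[of "t + 1"] six_vphi[of t] two_phi[of t] by (simp add: algebra_simps)
    have "t\<^sup>2 * ((t - 1) * (t - 2)) = t * (6 * vphi t)"
      by (simp add: six_vphi power2_eq_square)
    then have 4: "6 * (t\<^sup>2 * ((t - 1) * (t - 2)) div 6) = t\<^sup>2 * ((t - 1) * (t - 2))"
      by simp
    show "P (t + 1) div 30 - 3 * (phi (t + 1))\<^sup>2 + 4 * vphi (t + 1) + 2 * phi (t + 1) =
        P t div 30 - 3 * (phi t)\<^sup>2 + 4 * vphi t + 2 * phi t
          + 6 * (t\<^sup>2 * ((t - 1) * (t - 2)) div 6)"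
      unfolding 1 2 3 4 unfolding p using two_phi[of t]
      by (simp add: algebra_simps eval_nat_numeral)
  qed (simp add: P_def phi_def vphi_def)
  then show ?thesis by (simp add: sigma3_def P_def)
qed

end

theory Submission
  imports Defs Complex_Main
begin

text \<open>
  Let \<open>z = 2^(m-1) * l\<close>, so that \<open>alpha m l = 1 + 2z\<close>, and let \<open>M = 2^(3m-1)\<close> be the common
  exponent of \<open>A\<close> and \<open>B\<close>. The whole computation rests on \<open>M dvd 4z^3\<close>: multiples of \<open>4z^3\<close>
  vanish in exponents of \<open>A\<close> and \<open>B\<close>, so the binomial expansion of a power of \<open>1 + 2z\<close> may
  be cut off after \<open>z^2\<close>. In particular \<open>(1 + 2z)^(-k)\<close> becomes the polynomial \<open>twist z k\<close>,
  and the geometric sum of the first \<open>k\<close> of these powers becomes \<open>twist_sum z k\<close>, for every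
  integer \<open>k\<close>.

  Since \<open>B^-1 A B = A C\<close> and \<open>A^-1 B A = B C^-1\<close>, the defining relations give
  \<open>A^k B = B A^h C^k\<close> and \<open>B^k A = A B^h C^-k\<close> with \<open>h = twist_sum z k\<close>. Evaluating
  \<open>A^(1+2z) B\<close> in two ways shows that \<open>A^(2z^2)\<close> is the inverse of \<open>B^(2z^2)\<close> (lemma
  \<open>A_pow_eq_B_pow\<close>). This element, called \<open>W 1\<close>, is therefore central; moreover
  \<open>(W 1)^(2z) = 1\<close> and \<open>C^(4z^2) = 1\<close>.

  With these facts every element \<open>A^(i+2zi') B^(j+2zj') C^(k+2zk') W t\<close> can be multiplied on
  the right by \<open>A\<close>, \<open>B^b\<close> or \<open>C^c\<close>, and the new seven parameters are explicit functions of
  the old ones (lemmas \<open>nf_mult_A\<close>, \<open>nf_mult_B\<close>, \<open>nf_mult_C\<close>). Multiplying by \<open>A^a B^b C^c\<close>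
  is thus an explicit recursion on the parameters. The exponents of the theorem satisfy this
  recursion as identities between integers, with no congruence involved (lemmas
  \<open>expo_A_step\<close> to \<open>expo_central_step\<close>), and they vanish at \<open>n = 0\<close>; two-sided induction on
  \<open>n\<close> gives the formula for all integers \<open>n\<close>.
\<close>

section \<open>Conjugation and integer powers\<close>

context group begin

text \<open>
  A closed form for the powers of an element is verified by a single step upwards: the step
  holds at all integers, so cancelling the last factor gives the step downwards.
\<close>
lemma int_pow_closed_form:
  fixes f :: "int \<Rightarrow> 'a"
  assumes h: "h \<in> carrier G" and f: "\<And>k. f k \<in> carrier G"
    and step: "\<And>k. f (k + 1) = f k \<otimes> h"
  shows "f k = f 0 \<otimes> h [^] k"
proof (induction k rule: int_induct[where k = 0])
  case base
  show ?case using f by simp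
next
  case (step1 i)
  have "f (i + 1) = f 0 \<otimes> (h [^] i \<otimes> h [^] (1::int))"
    using step1 step h f by (simp add: m_assoc)
  then show ?case using h by (simp add: int_pow_mult)
next
  case (step2 i)
  have "f (i - 1) \<otimes> h = f i" using step[of "i - 1"] by simp
  also have "\<dots> = f 0 \<otimes> (h [^] (i - 1) \<otimes> h [^] (1::int))"
    using step2 h by (simp add: int_pow_mult[symmetric] del: int_pow_1)
  finally have "f (i - 1) \<otimes> h = (f 0 \<otimes> h [^] (i - 1)) \<otimes> h"
    using h f by (simp add: m_assoc)
  then show ?case using h f by simp
qed

definition conj_by :: "'a \<Rightarrow> 'a \<Rightarrow> 'a" where
  "conj_by h g = inv h \<otimes> g \<otimes> h"

lemma conj_by_closed [simp]: "g \<in> carrier G \<Longrightarrow> h \<in> carrier G \<Longrightarrow> conj_by h g \<in> carrier G"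
  by (simp add: conj_by_def)

lemma conj_by_mult:
  assumes "g \<in> carrier G" "g' \<in> carrier G" "h \<in> carrier G"
  shows "conj_by h (g \<otimes> g') = conj_by h g \<otimes> conj_by h g'"
proof -
  have "h \<otimes> (inv h \<otimes> w) = w" if "w \<in> carrier G" for w
    using that assms by (simp add: m_assoc[symmetric])
  then show ?thesis using assms by (simp add: conj_by_def m_assoc)
qed

lemma mult_conj_by:
  "g \<in> carrier G \<Longrightarrow> h \<in> carrier G \<Longrightarrow> h \<otimes> conj_by h g = g \<otimes> h"
  by (simp add: conj_by_def m_assoc[symmetric])

lemma conj_by_eq_iff:
  assumes "g \<in> carrier G" "h \<in> carrier G" "g' \<in> carrier G"
  shows "conj_by h g = g' \<longleftrightarrow> g \<otimes> h = h \<otimes> g'"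
  using assms mult_conj_by[of g h] by (metis conj_by_closed Units_eq Units_l_cancel)

lemma conj_by_int_pow:
  assumes "g \<in> carrier G" "h \<in> carrier G"
  shows "conj_by h (g [^] (k::int)) = conj_by h g [^] k"
proof -
  have "conj_by h (g [^] k) = conj_by h (g [^] (0::int)) \<otimes> conj_by h g [^] k"
    by (rule int_pow_closed_form)
       (use assms in \<open>simp_all add: int_pow_mult int_pow_1 conj_by_mult\<close>)
  moreover have "conj_by h \<one> = \<one>" using assms by (simp add: conj_by_def)
  ultimately show ?thesis using assms by simp
qed

lemma conj_by_by_mult:
  assumes "g \<in> carrier G" "h \<in> carrier G" "h' \<in> carrier G"
  shows "conj_by (h \<otimes> h') g = conj_by h' (conj_by h g)"
  using assms by (simp add: conj_by_def m_assoc inv_mult_group)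

lemma int_pow_eq_of_dvd:
  assumes "g \<in> carrier G" "g [^] (M::int) = \<one>" "M dvd i - j"
  shows "g [^] i = g [^] j"
proof -
  obtain q where "i - j = M * q" using assms(3) by (rule dvdE)
  then have "i = j + M * q" by simp
  then show ?thesis using assms by (simp add: int_pow_mult int_pow_pow[symmetric])
qed

end

section \<open>Conjugation by an element that raises to the power \<open>1 + 2 * z\<close>\<close>

text \<open>
  This is \<open>(1 + 2z)\<^sup>-\<^sup>k\<close> with its binomial expansion cut off before the term in \<open>z\<^sup>3\<close>.
\<close>
definition twist :: "int \<Rightarrow> int \<Rightarrow> int" where
  "twist z k = 1 - 2 * z * k + 2 * z\<^sup>2 * k * (k + 1)"

text \<open>
  This is the sum of \<open>twist z i\<close> over \<open>0 \<le> i < k\<close>, extended to negative \<open>k\<close> as a polynomial.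
\<close>
definition twist_sum :: "int \<Rightarrow> int \<Rightarrow> int" where
  "twist_sum z k = k - 2 * z * phi k + 4 * z\<^sup>2 * vphi (k + 1)"

lemma phi_add1: "phi (k + 1) = phi k + k"
  using two_phi[of k] two_phi[of "k + 1"] by (simp add: algebra_simps)

lemma vphi_add1: "vphi (k + 1) = vphi k + phi k"
  using two_phi[of k] six_vphi[of k] six_vphi[of "k + 1"] by (simp add: algebra_simps)

lemma twist_sum_add1: "twist_sum z (k + 1) = twist_sum z k + twist z k"
proof -
  have "2 * z\<^sup>2 * (2 * phi (k + 1)) = 2 * z\<^sup>2 * k * (k + 1)"
    unfolding two_phi by simp
  then show ?thesis
    unfolding twist_sum_def twist_def vphi_add1[of "k + 1"] phi_add1[of k]
    by (simp add: algebra_simps)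
qed

lemma phi_0 [simp]: "phi 0 = 0"
  by (simp add: phi_def)

lemma twist_sum_0 [simp]: "twist_sum z 0 = 0"
  by (simp add: twist_sum_def phi_def vphi_def)

text \<open>
  The factor \<open>3\<close> enters through the denominators of binomial coefficients \<open>vphi\<close>;
  coprimality to \<open>M\<close> is what allows clearing it.
\<close>
locale small_exponent = group G for G (structure) +
  fixes z M :: int
  assumes M_dvd: "M dvd 4 * z ^ 3" and coprime_M_3: "coprime M 3"
begin

lemma M_dvd_of_three_mult:
  assumes "3 * e = 4 * z ^ 3 * q"
  shows "M dvd e"
proof -
  have "M dvd 3 * e" unfolding assms using M_dvd by (rule dvd_mult2)
  then show ?thesis using coprime_M_3 by (simp add: coprime_dvd_mult_right_iff)
qed

lemma M_dvd_of_mult: "e = 4 * z ^ 3 * q \<Longrightarrow> M dvd e"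
  using M_dvd by simp

context
  fixes g d
  assumes g [simp]: "g \<in> carrier G" and d [simp]: "d \<in> carrier G"
    and g_M: "g [^] M = \<one>" and conj: "conj_by d g = g [^] (1 + 2 * z)"
begin

lemma pow_eq: "M dvd i - j \<Longrightarrow> g [^] i = g [^] j"
  using g_M by (rule int_pow_eq_of_dvd[OF g])

text \<open>
  The elements \<open>conj_by (d [^] k) (g [^] twist z k)\<close> do not depend on \<open>k\<close>, because
  \<open>(1 + 2 * z) * twist z (k + 1)\<close> and \<open>twist z k\<close> differ by a multiple of \<open>4 * z ^ 3\<close>.
\<close>
lemma conj_by_pow_twist: "conj_by (d [^] k) (g [^] twist z k) = g"
proof -
  have "conj_by (d [^] k) (g [^] twist z k)
      = conj_by (d [^] (0::int)) (g [^] twist z 0) \<otimes> \<one> [^] k"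
  proof (rule int_pow_closed_form)
    fix k
    have "(1 + 2 * z) * twist z (k + 1) - twist z k = 4 * z ^ 3 * ((k + 1) * (k + 2))"
      by (simp add: twist_def algebra_simps eval_nat_numeral)
    then have "g [^] ((1 + 2 * z) * twist z (k + 1)) = g [^] twist z k"
      by (intro pow_eq M_dvd_of_mult)
    then have "conj_by d (g [^] twist z (k + 1)) = g [^] twist z k"
      by (simp add: conj_by_int_pow conj int_pow_pow)
    moreover have "d [^] (k + 1) = d \<otimes> d [^] k"
      using int_pow_mult[OF d, of 1 k] by (simp add: add.commute)
    ultimately show "conj_by (d [^] (k + 1)) (g [^] twist z (k + 1))
        = conj_by (d [^] k) (g [^] twist z k) \<otimes> \<one>"
      by (simp add: conj_by_by_mult)
  qed simp_all
  moreover have "conj_by \<one> g = g" by (simp add: conj_by_def)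
  ultimately show ?thesis by (simp add: twist_def)
qed

lemma pow_mult_twist: "d [^] k \<otimes> g [^] j = g [^] (j * twist z k) \<otimes> d [^] (k::int)"
proof -
  have "d [^] k \<otimes> g [^] j = d [^] k \<otimes> conj_by (d [^] k) ((g [^] twist z k) [^] j)"
    by (simp add: conj_by_int_pow conj_by_pow_twist)
  then show ?thesis by (simp add: mult_conj_by int_pow_pow mult.commute)
qed

text \<open>
  For \<open>k \<ge> 0\<close>, in \<open>(g \<otimes> d) [^] k\<close> every factor \<open>g\<close> has to move left past the powers
  \<open>d [^] i\<close> with \<open>i < k\<close>, at the cost of the exponent \<open>twist z i\<close>.
\<close>
lemma mult_pow_twist_sum: "(g \<otimes> d) [^] k = g [^] twist_sum z k \<otimes> d [^] (k::int)"
proof -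
  have "g [^] twist_sum z k \<otimes> d [^] k
      = g [^] twist_sum z 0 \<otimes> d [^] (0::int) \<otimes> (g \<otimes> d) [^] k"
  proof (rule int_pow_closed_form)
    fix k
    have "g [^] twist_sum z (k + 1) \<otimes> d [^] (k + 1)
        = g [^] twist_sum z k \<otimes> (g [^] (1 * twist z k) \<otimes> d [^] k) \<otimes> d"
      by (simp add: twist_sum_add1 int_pow_mult m_assoc)
    also have "\<dots> = g [^] twist_sum z k \<otimes> (d [^] k \<otimes> g [^] (1::int)) \<otimes> d"
      by (simp only: pow_mult_twist)
    finally show "g [^] twist_sum z (k + 1) \<otimes> d [^] (k + 1)
        = g [^] twist_sum z k \<otimes> d [^] k \<otimes> (g \<otimes> d)"
      by (simp add: m_assoc)
  qed simp_all
  then show ?thesis by simp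
qed

end

end

section \<open>A central power of the generators\<close>

text \<open>
  The relations are invariant under exchanging \<open>A\<close> with \<open>B\<close> and the commutator with its
  inverse. For this reason the second relation is stated as conjugation by the inverse of
  \<open>[A, B]\<close>, which is \<open>[B, A]\<close>.
\<close>
locale macdonald = small_exponent +
  fixes A B
  assumes A [simp]: "A \<in> carrier G" and B [simp]: "B \<in> carrier G"
    and A_M: "A [^] M = \<one>" and B_M: "B [^] M = \<one>"
    and conj_C_A: "conj_by (inv A \<otimes> inv B \<otimes> A \<otimes> B) A = A [^] (1 + 2 * z)"
    and conj_inv_C_B: "conj_by (inv (inv A \<otimes> inv B \<otimes> A \<otimes> B)) B = B [^] (1 + 2 * z)"
begin

definition C where "C = inv A \<otimes> inv B \<otimes> A \<otimes> B"

lemma C [simp]: "C \<in> carrier G" by (simp add: C_def)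

lemmas A_cong = pow_eq[OF A C A_M conj_C_A[folded C_def]]
lemmas B_cong = pow_eq[OF B inv_closed[OF C] B_M conj_inv_C_B[folded C_def]]

lemma C_mult_A: "C [^] k \<otimes> A [^] j = A [^] (j * twist z k) \<otimes> C [^] (k::int)"
  by (rule pow_mult_twist) (simp_all add: A_M conj_C_A[folded C_def])

lemma C_mult_B: "C [^] k \<otimes> B [^] j = B [^] (j * twist z (- k)) \<otimes> C [^] (k::int)"
  using pow_mult_twist[OF B inv_closed[OF C] B_M conj_inv_C_B[folded C_def], of "-k" j]
  by (simp add: int_pow_inv[symmetric] int_pow_neg)

lemma cancel_left [simp]:
  "g \<in> carrier G \<Longrightarrow> w \<in> carrier G \<Longrightarrow> g \<otimes> (inv g \<otimes> w) = w"
  "g \<in> carrier G \<Longrightarrow> w \<in> carrier G \<Longrightarrow> inv g \<otimes> (g \<otimes> w) = w"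
  by (simp_all add: m_assoc[symmetric])

lemma A_mult_B: "A [^] k \<otimes> B = B \<otimes> A [^] twist_sum z k \<otimes> C [^] (k::int)"
proof -
  have "conj_by B A = A \<otimes> C" by (simp add: conj_by_def C_def m_assoc)
  then have "conj_by B (A [^] k) = A [^] twist_sum z k \<otimes> C [^] k"
    by (simp add: conj_by_int_pow mult_pow_twist_sum A_M conj_C_A[folded C_def])
  then show ?thesis by (simp add: conj_by_eq_iff m_assoc)
qed

lemma B_mult_A: "B [^] k \<otimes> A = A \<otimes> B [^] twist_sum z k \<otimes> C [^] (- k::int)"
proof -
  have "conj_by A B = B \<otimes> inv C" by (simp add: conj_by_def C_def m_assoc inv_mult_group)
  then have "conj_by A (B [^] k) = B [^] twist_sum z k \<otimes> inv C [^] k"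
    by (simp add: conj_by_int_pow mult_pow_twist_sum B_M conj_inv_C_B[folded C_def])
  then show ?thesis by (simp add: conj_by_eq_iff m_assoc int_pow_inv int_pow_neg)
qed

lemma twist_sum_alpha: "M dvd twist_sum z (1 + 2 * z) - (1 + 2 * z - 2 * z\<^sup>2)"
proof (rule M_dvd_of_three_mult)
  have "3 * twist_sum z (1 + 2 * z) 
      = 3 * (1 + 2 * z) - 3 * z * (2 * phi (1 + 2 * z)) + 2 * z\<^sup>2 * (6 * vphi (2 + 2 * z))"
    by (simp add: twist_sum_def algebra_simps)
  then show "3 * (twist_sum z (1 + 2 * z) - (1 + 2 * z - 2 * z\<^sup>2))
      = 4 * z ^ 3 * (2 * (1 + z) * (1 + 2 * z) - 3)"
    unfolding two_phi six_vphi by (simp add: algebra_simps eval_nat_numeral)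
qed

text \<open>
  With \<open>x = 1 + 2 * z\<close> and \<open>y = 2 * z\<^sup>2\<close>, the element \<open>A [^] x \<otimes> B\<close> can be rewritten in two
  ways. One moves \<open>A [^] x\<close> past \<open>B\<close>. The other moves \<open>B [^] x\<close> past \<open>A\<close> and then conjugates
  by \<open>C\<close>, which turns \<open>A\<close> into \<open>A [^] x\<close> and \<open>B [^] x\<close> back into \<open>B\<close>. In both cases
  \<open>twist_sum z x\<close> is \<open>x - y\<close> modulo \<open>M\<close>, and the comparison leaves exactly
  \<open>A [^] (- y) \<otimes> B [^] (- y) = \<one>\<close>.
\<close>
lemma A_pow_eq_B_pow: "A [^] (2 * z\<^sup>2) = B [^] (- 2 * z\<^sup>2)"
proof -
  define x where "x = 1 + 2 * z"
  define y where "y = 2 * z\<^sup>2"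
  have 1: "A [^] x \<otimes> B = B \<otimes> A [^] (x - y) \<otimes> C [^] x"
    using A_mult_B[of x] A_cong[OF twist_sum_alpha] by (simp add: x_def y_def)
  have 2: "B [^] x \<otimes> A = A \<otimes> B [^] (x - y) \<otimes> C [^] (- x)"
    using B_mult_A[of x] B_cong[OF twist_sum_alpha] by (simp only: x_def y_def)
  have "B [^] x \<otimes> A \<otimes> C [^] x = A \<otimes> B [^] (x - y)"
    unfolding 2 by (simp add: m_assoc int_pow_mult[symmetric])
  then have "conj_by C (B [^] x) \<otimes> conj_by C A \<otimes> conj_by C (C [^] x)
      = conj_by C A \<otimes> conj_by C (B [^] (x - y))"
    by (simp add: conj_by_mult[symmetric])
  moreover have "conj_by C A = A [^] x" using conj_C_A by (simp add: C_def x_def)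
  moreover have "conj_by C (C [^] x) = C [^] x"
    by (simp add: conj_by_int_pow) (simp add: conj_by_def)
  moreover have CB: "conj_by C (B [^] j) = B [^] (j * twist z 1)" for j
    using C_mult_B[of "- 1" j] by (simp add: conj_by_def int_pow_neg m_assoc)
  moreover have "B [^] (x * twist z 1) = B [^] (1::int)"
    by (rule B_cong, rule M_dvd_of_mult[where q = 2])
       (simp add: x_def twist_def algebra_simps eval_nat_numeral)
  moreover have "B [^] ((x - y) * twist z 1) = B [^] (1 - y)"
    by (rule B_cong, rule M_dvd_of_mult[where q = "3 - 2 * z"])
       (simp add: x_def y_def twist_def algebra_simps eval_nat_numeral)
  ultimately have 3: "B \<otimes> A [^] x \<otimes> C [^] x = A [^] x \<otimes> B [^] (1 - y)" by simp
  have "A [^] x \<otimes> B [^] (1 - y) = A [^] x \<otimes> B \<otimes> B [^] (- y)"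
    using int_pow_mult[OF B, of 1 "- y"] by (simp add: m_assoc)
  also have "\<dots> = B \<otimes> A [^] (x - y) \<otimes> (C [^] x \<otimes> B [^] (- y))"
    unfolding 1 by (simp add: m_assoc)
  also have "C [^] x \<otimes> B [^] (- y) = B [^] (- y * twist z (- x)) \<otimes> C [^] x"
    by (rule C_mult_B)
  also have "B [^] (- y * twist z (- x)) = B [^] (- y)"
    by (rule B_cong, rule M_dvd_of_mult[where q = "- x - z * x * (x - 1)"])
       (simp add: x_def y_def twist_def algebra_simps eval_nat_numeral)
  finally have "B \<otimes> A [^] x \<otimes> C [^] x = B \<otimes> (A [^] (x - y) \<otimes> B [^] (- y)) \<otimes> C [^] x"
    unfolding 3 by (simp add: m_assoc)
  then have "A [^] x \<otimes> C [^] x = (A [^] (x - y) \<otimes> B [^] (- y)) \<otimes> C [^] x"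
    by (simp add: m_assoc)
  then have "A [^] x = A [^] (x - y) \<otimes> B [^] (- y)" by (subst (asm) right_cancel) simp_all
  moreover have "A [^] x = A [^] (x - y) \<otimes> A [^] y" by (simp add: int_pow_mult[symmetric])
  ultimately have "A [^] y = B [^] (- y)" by simp
  then show ?thesis by (simp add: y_def)
qed

text \<open>
  The powers of the central element, indexed by their exponent. Working with \<open>W t\<close> instead
  of powers of \<open>A\<close> keeps the central part apart from the three noncommuting factors.
\<close>
definition W where "W t = A [^] (2 * z\<^sup>2 * t)"

lemma W_eq_B: "W t = B [^] (- 2 * z\<^sup>2 * t)"
proof -
  have "W t = (A [^] (2 * z\<^sup>2)) [^] t" by (simp only: W_def int_pow_pow A)
  then show ?thesis by (simp only: A_pow_eq_B_pow int_pow_pow B)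
qed

lemma W [simp]: "W t \<in> carrier G" by (simp add: W_def)

lemma W_add: "W (s + t) = W s \<otimes> W t" by (simp add: W_def int_pow_mult distrib_left)

lemma W_cong:
  assumes "2 * z dvd s - t"
  shows "W s = W t"
proof -
  obtain q where "s - t = 2 * z * q" using assms by (rule dvdE)
  then have "2 * z\<^sup>2 * s - 2 * z\<^sup>2 * t = 4 * z ^ 3 * q"
    by (simp add: right_diff_distrib[symmetric] power2_eq_square power3_eq_cube)
  then show ?thesis unfolding W_def by (intro A_cong M_dvd_of_mult)
qed

lemma W_comm:
  fixes i :: int
  shows "W t \<otimes> A [^] i = A [^] i \<otimes> W t" "W t \<otimes> B [^] i = B [^] i \<otimes> W t"
  "W t \<otimes> C [^] i = C [^] i \<otimes> W t"
proof -
  show "W t \<otimes> A [^] i = A [^] i \<otimes> W t" by (simp add: W_def int_pow_mult[symmetric] add.commute)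
  show "W t \<otimes> B [^] i = B [^] i \<otimes> W t" by (simp add: W_eq_B int_pow_mult[symmetric] add.commute)
  have "A [^] (2 * z\<^sup>2 * t * twist z i) = A [^] (2 * z\<^sup>2 * t)"
    by (rule A_cong, rule M_dvd_of_mult[where q = "t * (- i + z * i * (i + 1))"])
       (simp add: twist_def algebra_simps eval_nat_numeral)
  then show "W t \<otimes> C [^] i = C [^] i \<otimes> W t"
    unfolding W_def using C_mult_A[of i "2 * z\<^sup>2 * t"] by simp
qed

lemma W_left_comm:
  fixes i :: int
  assumes "w \<in> carrier G"
  shows "W t \<otimes> (A [^] i \<otimes> w) = A [^] i \<otimes> (W t \<otimes> w)"
    "W t \<otimes> (B [^] i \<otimes> w) = B [^] i \<otimes> (W t \<otimes> w)"
    "W t \<otimes> (C [^] i \<otimes> w) = C [^] i \<otimes> (W t \<otimes> w)"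
  using assms by (simp_all add: m_assoc[symmetric] W_comm)

text \<open>
  For \<open>k = 4 * z\<^sup>2\<close> the power \<open>A [^] k\<close> is central, while moving it past \<open>B\<close> produces the
  factor \<open>C [^] k\<close>.
\<close>
lemma C_pow_4z2: "C [^] (4 * z\<^sup>2) = \<one>"
proof -
  define k where "k = 4 * z\<^sup>2"
  have "M dvd twist_sum z k - k"
  proof (rule M_dvd_of_three_mult)
    have "3 * twist_sum z k = 3 * k - 3 * z * (2 * phi k) + 2 * z\<^sup>2 * (6 * vphi (k + 1))"
      by (simp add: twist_sum_def algebra_simps)
    then show "3 * (twist_sum z k - k) = 4 * z ^ 3 * (- 3 * (k - 1) + 2 * z * (k + 1) * (k - 1))"
      unfolding two_phi six_vphi k_def by (simp add: algebra_simps eval_nat_numeral)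
  qed
  then have "A [^] twist_sum z k = A [^] k" by (rule A_cong)
  then have "A [^] k \<otimes> B = B \<otimes> A [^] k \<otimes> C [^] k" using A_mult_B[of k] by simp
  moreover have "A [^] k \<otimes> B = B \<otimes> A [^] k"
    using W_comm(2)[of 2 1] by (simp add: W_def k_def mult.commute)
  ultimately show ?thesis by (simp add: k_def)
qed

lemma C_cong: "4 * z\<^sup>2 dvd i - j \<Longrightarrow> C [^] i = C [^] j"
  using C_pow_4z2 by (rule int_pow_eq_of_dvd[OF C])

section \<open>Commutation rules for exponents divisible by \<open>2 * z\<close>\<close>

lemma W_int_pow: "W t [^] (r::int) = W (t * r)"
  by (simp add: W_def int_pow_pow mult.assoc)

lemma W_0 [simp]: "W 0 = \<one>" by (simp add: W_def)

lemma A_2z_mult_B: "A [^] (2 * z) \<otimes> B = B \<otimes> A [^] (2 * z) \<otimes> C [^] (2 * z) \<otimes> W 1"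
proof -
  have "M dvd twist_sum z (2 * z) - (2 * z + 2 * z\<^sup>2 * 1)"
  proof (rule M_dvd_of_three_mult)
    have "3 * twist_sum z (2 * z) = 6 * z - 3 * z * (2 * phi (2 * z)) + 2 * z\<^sup>2 * (6 * vphi (2 * z + 1))"
      by (simp add: twist_sum_def algebra_simps)
    then show "3 * (twist_sum z (2 * z) - (2 * z + 2 * z\<^sup>2 * 1)) = 4 * z ^ 3 * (4 * z\<^sup>2 - 4)"
      unfolding two_phi six_vphi by (simp add: algebra_simps eval_nat_numeral)
  qed
  then have "A [^] twist_sum z (2 * z) = A [^] (2 * z + 2 * z\<^sup>2 * 1)" by (rule A_cong)
  also have "\<dots> = A [^] (2 * z) \<otimes> W 1" by (simp only: int_pow_mult A W_def)
  finally show ?thesis using A_mult_B[of "2 * z"] by (simp add: m_assoc W_comm)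
qed

lemma C_2z_mult:
  "C [^] (2 * z * k) \<otimes> A [^] j = A [^] j \<otimes> C [^] (2 * z * k) \<otimes> W (- 2 * k * j)"
  "C [^] (2 * z * k) \<otimes> B [^] j = B [^] j \<otimes> C [^] (2 * z * k) \<otimes> W (- 2 * k * j)"
proof -
  have "A [^] (j * twist z (2 * z * k)) = A [^] (j + 2 * z\<^sup>2 * (- 2 * k * j))"
    by (rule A_cong, rule M_dvd_of_mult[where q = "j * k * (1 + 2 * z * k)"])
       (simp add: twist_def algebra_simps eval_nat_numeral)
  also have "\<dots> = A [^] j \<otimes> W (- 2 * k * j)" by (simp only: int_pow_mult A W_def)
  finally show "C [^] (2 * z * k) \<otimes> A [^] j = A [^] j \<otimes> C [^] (2 * z * k) \<otimes> W (- 2 * k * j)"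
    unfolding C_mult_A by (simp add: m_assoc W_comm)
  have "B [^] (j * twist z (- (2 * z * k))) = B [^] (j + - 2 * z\<^sup>2 * (- 2 * k * j))"
    by (rule B_cong, rule M_dvd_of_mult[where q = "j * k * (- 1 + 2 * z * k)"])
       (simp add: twist_def algebra_simps eval_nat_numeral)
  also have "\<dots> = B [^] j \<otimes> W (- 2 * k * j)" by (simp only: int_pow_mult B W_eq_B)
  finally show "C [^] (2 * z * k) \<otimes> B [^] j = B [^] j \<otimes> C [^] (2 * z * k) \<otimes> W (- 2 * k * j)"
    unfolding C_mult_B by (simp add: m_assoc W_comm)
qed

lemma C_2z_comm_A_2z:
  "C [^] (2 * z * k) \<otimes> A [^] (2 * z * r) = A [^] (2 * z * r) \<otimes> C [^] (2 * z * k)"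
proof -
  have "W (- 2 * k * (2 * z * r)) = W 0" by (rule W_cong) (simp add: mult.assoc mult.left_commute[of _ z])
  then show ?thesis using C_2z_mult(1)[of k "2 * z * r"] by simp
qed

text \<open>
  Conjugating \<open>B\<close> by \<open>A [^] (- 2 * z)\<close> gives \<open>h = B \<otimes> C [^] (2 * z) \<otimes> W 1\<close>, whose powers are
  again explicit because \<open>C [^] (2 * z)\<close> and \<open>B\<close> commute up to a power of \<open>W\<close>. Read as a
  conjugate of \<open>A [^] (2 * z)\<close> by \<open>B [^] j\<close>, the result is a product of commuting elements,
  which can be raised to the power \<open>r\<close>.
\<close>
lemma A_2z_mult_B_pow:
  "A [^] (2 * z * r) \<otimes> B [^] j
    = B [^] j \<otimes> A [^] (2 * z * r) \<otimes> C [^] (2 * z * j * r) \<otimes> W ((j - 2 * phi j) * r)"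
proof -
  define h where "h = B \<otimes> C [^] (2 * z) \<otimes> W 1"
  have h: "h \<in> carrier G" by (simp add: h_def)
  have CA: "C [^] (2 * z * k) \<otimes> A [^] (2 * z) = A [^] (2 * z) \<otimes> C [^] (2 * z * k)" for k
    using C_2z_comm_A_2z[of k 1] by simp
  have "B [^] j \<otimes> C [^] (2 * z * j) \<otimes> W (j - 2 * phi j)
      = B [^] (0::int) \<otimes> C [^] (2 * z * 0) \<otimes> W (0 - 2 * phi 0) \<otimes> h [^] j"
  proof (rule int_pow_closed_form[OF h])
    fix j
    have "B [^] (j + 1) \<otimes> C [^] (2 * z * (j + 1)) \<otimes> W (j + 1 - 2 * phi (j + 1))
      = B [^] j \<otimes> (B \<otimes> C [^] (2 * z * j)) \<otimes> C [^] (2 * z)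
         \<otimes> W (- 2 * j * 1 + ((j - 2 * phi j) + 1))"
    proof -
      have "B [^] (j + 1) = B [^] j \<otimes> B" by (simp add: int_pow_mult)
      moreover have "C [^] (2 * z * (j + 1)) = C [^] (2 * z * j) \<otimes> C [^] (2 * z)"
        by (simp add: distrib_left int_pow_mult)
      moreover have "W (j + 1 - 2 * phi (j + 1)) = W (- 2 * j * 1 + ((j - 2 * phi j) + 1))"
        by (rule arg_cong[where f = W]) (simp add: phi_add1)
      ultimately show ?thesis by (simp add: m_assoc)
    qed
    also have "\<dots> = B [^] j \<otimes> (B [^] (1::int) \<otimes> C [^] (2 * z * j) \<otimes> W (- 2 * j * 1)) \<otimes> C [^] (2 * z)
         \<otimes> W ((j - 2 * phi j)) \<otimes> W 1"
      unfolding W_add[of "- 2 * j * 1"] W_add[of _ 1] by (simp add: m_assoc W_left_comm W_comm)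
    also have "\<dots> = B [^] j \<otimes> (C [^] (2 * z * j) \<otimes> B [^] (1::int)) \<otimes> C [^] (2 * z)
         \<otimes> W ((j - 2 * phi j)) \<otimes> W 1"
      by (simp only: C_2z_mult)
    finally show "B [^] (j + 1) \<otimes> C [^] (2 * z * (j + 1)) \<otimes> W (j + 1 - 2 * phi (j + 1))
      = B [^] j \<otimes> C [^] (2 * z * j) \<otimes> W (j - 2 * phi j) \<otimes> h"
      using W_left_comm(2)[of _ _ 1] by (simp add: h_def m_assoc W_left_comm W_comm)
  qed simp_all
  then have hj: "h [^] j = B [^] j \<otimes> C [^] (2 * z * j) \<otimes> W (j - 2 * phi j)"
    using h by (simp add: phi_def)
  have "A [^] (2 * z) \<otimes> B = h \<otimes> A [^] (2 * z)"
    unfolding A_2z_mult_B h_def using CA[of 1] by (simp add: m_assoc W_comm) (simp add: m_assoc[symmetric])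
  then have "conj_by (A [^] (2 * z)) h = B" using h by (simp add: conj_by_eq_iff)
  then have "conj_by (A [^] (2 * z)) (h [^] j) = B [^] j" using h by (simp add: conj_by_int_pow)
  then have "A [^] (2 * z) \<otimes> B [^] j = h [^] j \<otimes> A [^] (2 * z)"
    using h by (simp add: conj_by_eq_iff)
  also have "\<dots> = B [^] j \<otimes> (A [^] (2 * z) \<otimes> (C [^] (2 * z * j) \<otimes> W (j - 2 * phi j)))"
    unfolding hj using CA[of j] by (simp add: m_assoc W_comm) (simp add: m_assoc[symmetric])
  finally have "conj_by (B [^] j) (A [^] (2 * z)) = A [^] (2 * z) \<otimes> (C [^] (2 * z * j) \<otimes> W (j - 2 * phi j))"
    by (simp add: conj_by_eq_iff)
  then have "conj_by (B [^] j) ((A [^] (2 * z)) [^] r)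
      = (A [^] (2 * z) \<otimes> (C [^] (2 * z * j) \<otimes> W (j - 2 * phi j))) [^] r"
    by (simp add: conj_by_int_pow)
  also have "\<dots> = (A [^] (2 * z)) [^] r \<otimes> (C [^] (2 * z * j) \<otimes> W (j - 2 * phi j)) [^] r"
    using CA[of j] by (intro int_pow_mult_distrib) (simp_all add: m_assoc W_comm, simp add: m_assoc[symmetric])
  also have "(C [^] (2 * z * j) \<otimes> W (j - 2 * phi j)) [^] r = (C [^] (2 * z * j)) [^] r \<otimes> W (j - 2 * phi j) [^] r"
    by (intro int_pow_mult_distrib) (simp_all add: W_comm)
  finally show ?thesis
    by (simp add: conj_by_eq_iff int_pow_pow W_int_pow m_assoc)
qed

lemma B_mult_A_2z_pow:
  "B [^] j \<otimes> A [^] (2 * z * r)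
    = A [^] (2 * z * r) \<otimes> B [^] j \<otimes> C [^] (- 2 * z * j * r) \<otimes> W (- (j - 2 * phi j) * r)"
proof -
  have "A [^] (2 * z * - r) \<otimes> B [^] j
    = B [^] j \<otimes> A [^] (2 * z * - r) \<otimes> C [^] (2 * z * j * - r) \<otimes> W ((j - 2 * phi j) * - r)"
    by (rule A_2z_mult_B_pow)
  then have "B [^] j = A [^] (2 * z * r)
      \<otimes> (B [^] j \<otimes> A [^] (2 * z * - r) \<otimes> C [^] (2 * z * j * - r) \<otimes> W ((j - 2 * phi j) * - r))"
    by (simp add: int_pow_neg inv_solve_left')
  then have "B [^] j \<otimes> A [^] (2 * z * r) = A [^] (2 * z * r)
      \<otimes> (B [^] j \<otimes> A [^] (2 * z * - r) \<otimes> C [^] (2 * z * j * - r) \<otimes> W ((j - 2 * phi j) * - r))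
      \<otimes> A [^] (2 * z * r)"
    by (rule arg_cong)
  also have "\<dots> = A [^] (2 * z * r) \<otimes> B [^] j \<otimes> A [^] (2 * z * - r)
      \<otimes> (C [^] (2 * z * (j * - r)) \<otimes> A [^] (2 * z * r)) \<otimes> W ((j - 2 * phi j) * - r)"
    by (simp add: m_assoc W_comm mult.assoc)
  also have "\<dots> = A [^] (2 * z * r) \<otimes> B [^] j \<otimes> C [^] (2 * z * (j * - r)) \<otimes> W ((j - 2 * phi j) * - r)"
    unfolding C_2z_comm_A_2z by (simp add: m_assoc int_pow_neg)
  also have "(j - 2 * phi j) * - r = - (j - 2 * phi j) * r" by (simp add: algebra_simps)
  finally show ?thesis by (simp add: mult.assoc)
qed

section \<open>Normal forms\<close>

text \<open>
  Each exponent is split as \<open>i + 2 * z * i'\<close>. The splitting is not unique; it records which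
  contributions carry a factor \<open>2 * z\<close>, so that products of two of them can be moved into
  the central factor, as \<open>(2 * z)\<^sup>2\<close> is twice \<open>2 * z\<^sup>2\<close>.
\<close>
definition nf :: "int \<Rightarrow> int \<Rightarrow> int \<Rightarrow> int \<Rightarrow> int \<Rightarrow> int \<Rightarrow> int \<Rightarrow> 'a" where
  "nf i i' j j' k k' t = A [^] (i + 2 * z * i') \<otimes> B [^] (j + 2 * z * j') \<otimes> C [^] (k + 2 * z * k') \<otimes> W t"

lemma nf_closed [simp]: "nf i i' j j' k k' t \<in> carrier G"
  by (simp add: nf_def)

lemma nf_mult_C: "nf i i' j j' k k' t \<otimes> C [^] c = nf i i' j j' (k + c) k' t"
proof -
  have "C [^] (k + c + 2 * z * k') = C [^] (k + 2 * z * k') \<otimes> C [^] c"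
    by (simp add: int_pow_mult[symmetric] algebra_simps)
  then show ?thesis by (simp add: nf_def m_assoc W_comm)
qed

lemma nf_mult_B:
  "nf i i' j j' k k' t \<otimes> B [^] b = nf i i' (j + b) (j' + b * k) k k' (t - 2 * b * k' - b * k * (k - 1))"
proof -
  have "B [^] (b * twist z (- (k + 2 * z * k')))
      = B [^] (b + 2 * z * (b * k) + - 2 * z\<^sup>2 * (- 2 * b * k' - b * k * (k - 1)))"
    by (rule B_cong, rule M_dvd_of_mult[where q = "b * (2 * k * k' - k' + 2 * z * k'\<^sup>2)"])
       (simp add: twist_def algebra_simps eval_nat_numeral)
  also have "\<dots> = B [^] (b + 2 * z * (b * k)) \<otimes> W (- 2 * b * k' - b * k * (k - 1))"
    by (simp only: int_pow_mult B W_eq_B)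
  finally have "C [^] (k + 2 * z * k') \<otimes> B [^] b
      = B [^] (b + 2 * z * (b * k)) \<otimes> W (- 2 * b * k' - b * k * (k - 1)) \<otimes> C [^] (k + 2 * z * k')"
    by (simp only: C_mult_B)
  moreover have "B [^] (j + b + 2 * z * (j' + b * k)) = B [^] (j + 2 * z * j') \<otimes> B [^] (b + 2 * z * (b * k))"
    by (simp add: int_pow_mult[symmetric] algebra_simps)
  moreover have "W (t - 2 * b * k' - b * k * (k - 1)) = W (- 2 * b * k' - b * k * (k - 1)) \<otimes> W t"
    unfolding W_add[symmetric] by (rule arg_cong[where f = W]) simp
  moreover have "nf i i' j j' k k' t \<otimes> B [^] b
      = A [^] (i + 2 * z * i') \<otimes> B [^] (j + 2 * z * j') \<otimes> (C [^] (k + 2 * z * k') \<otimes> B [^] b) \<otimes> W t"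
    by (simp add: nf_def m_assoc W_comm)
  ultimately show ?thesis by (simp add: nf_def m_assoc W_comm W_left_comm)
qed

lemma twist_sum_shift:
  "M dvd twist_sum z (j + 2 * z * j')
      - (j + 2 * z * (j' - phi j) - 2 * z\<^sup>2 * ((2 * j - 1) * j' - 2 * vphi (j + 1)))"
proof (rule M_dvd_of_three_mult)
  let ?J = "j + 2 * z * j'"
  have "3 * (twist_sum z ?J - (j + 2 * z * (j' - phi j) - 2 * z\<^sup>2 * ((2 * j - 1) * j' - 2 * vphi (j + 1))))
    = 3 * (?J - j) - 3 * z * (2 * phi ?J) + 2 * z\<^sup>2 * (6 * vphi (?J + 1))
       - 6 * z * j' + 3 * z * (2 * phi j) + 6 * z\<^sup>2 * (2 * j - 1) * j' - 2 * z\<^sup>2 * (6 * vphi (j + 1))"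
    by (simp add: twist_sum_def algebra_simps)
  then show "3 * (twist_sum z ?J - (j + 2 * z * (j' - phi j) - 2 * z\<^sup>2 * ((2 * j - 1) * j' - 2 * vphi (j + 1))))
      = 4 * z ^ 3 * (- 3 * j'\<^sup>2 + (3 * j\<^sup>2 - 1) * j' + 6 * z * j * j'\<^sup>2 + 4 * z\<^sup>2 * j' ^ 3)"
    unfolding two_phi six_vphi by (simp add: algebra_simps eval_nat_numeral)
qed

text \<open>
  The new factor \<open>A\<close> travels left. Past \<open>C [^] K\<close> it becomes \<open>A \<otimes> A [^] (- 2 * z * k)\<close> up to
  \<open>W\<close>; past \<open>B [^] J\<close> the single \<open>A\<close> leaves \<open>C [^] (- J)\<close> behind, and
  \<open>X = A [^] (- 2 * z * k)\<close> then crosses both \<open>C [^] (- J)\<close> and the new power of \<open>B\<close>.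
\<close>
lemma nf_mult_A:
  "nf i i' j j' k k' t \<otimes> A = nf (i + 1) (i' - k) j (j' - phi j) (k - j) (k' - j' + k * j)
     (t + k * (k + 1) - 2 * k' + (2 * j - 1) * j' - 2 * vphi (j + 1) - k * j - 2 * k * phi j)"
proof -
  define I where "I = i + 2 * z * i'"
  define J where "J = j + 2 * z * j'"
  define K where "K = k + 2 * z * k'"
  define H where "H = twist_sum z J"
  define X where "X = A [^] (2 * z * - k)"
  have X [simp]: "X \<in> carrier G" by (simp add: X_def)
  have WX: "W t \<otimes> X = X \<otimes> W t" for t by (simp add: X_def W_comm)
  have W_left_X: "W t \<otimes> (X \<otimes> w) = X \<otimes> (W t \<otimes> w)" if "w \<in> carrier G" for t w
    using that by (simp add: X_def W_left_comm)
  have "A [^] (1 * twist z K) = A [^] (1 + 2 * z * - k + 2 * z\<^sup>2 * (k * (k + 1) - 2 * k'))"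
    by (rule A_cong, rule M_dvd_of_mult[where q = "2 * k * k' + k' + 2 * z * k'\<^sup>2"])
       (simp add: twist_def K_def algebra_simps eval_nat_numeral)
  also have "\<dots> = A \<otimes> X \<otimes> W (k * (k + 1) - 2 * k')"
    by (simp only: int_pow_mult A W_def X_def int_pow_1)
  finally have CA: "C [^] K \<otimes> A = A \<otimes> X \<otimes> C [^] K \<otimes> W (k * (k + 1) - 2 * k')"
    using C_mult_A[of K 1] by (simp add: m_assoc W_comm)
  have BA: "B [^] J \<otimes> A = A \<otimes> B [^] H \<otimes> C [^] (- J)"
    unfolding H_def by (rule B_mult_A)
  have "A [^] (2 * z * - k * twist z (- J)) = A [^] (2 * z * - k + 2 * z\<^sup>2 * (- 2 * k * j))"
    by (rule A_cong, rule M_dvd_of_mult[where q = "- 2 * k * j' - k * J * (J - 1)"])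
       (simp add: twist_def J_def algebra_simps eval_nat_numeral)
  also have "\<dots> = X \<otimes> W (- 2 * k * j)"
    by (simp only: int_pow_mult A W_def X_def)
  finally have CX: "C [^] (- J) \<otimes> X = X \<otimes> C [^] (- J) \<otimes> W (- 2 * k * j)"
    using C_mult_A[of "- J" "2 * z * - k"] by (simp add: m_assoc W_comm X_def)
  \<comment> \<open>\<open>H\<close> is \<open>H0 - 2 * z\<^sup>2 * v\<close> modulo \<open>M\<close>, and the second term goes into the central factor.\<close>
  define H0 where "H0 = j + 2 * z * (j' - phi j)"
  define v where "v = (2 * j - 1) * j' - 2 * vphi (j + 1)"
  have "B [^] H = B [^] (H0 + - 2 * z\<^sup>2 * v)"
    using B_cong[OF twist_sum_shift] by (simp add: H_def J_def H0_def v_def)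
  also have "\<dots> = B [^] H0 \<otimes> W v" by (simp only: int_pow_mult B W_eq_B)
  finally have BH: "B [^] H = B [^] H0 \<otimes> W v" .
  have BX: "B [^] H0 \<otimes> X = X \<otimes> B [^] H0 \<otimes> C [^] (2 * z * (j * k)) \<otimes> W ((j - 2 * phi j) * k)"
  proof -
    \<comment> \<open>Only \<open>H0\<close> modulo \<open>2 * z\<close> matters here, so the summand \<open>2 * z * (j' - phi j)\<close> drops out.\<close>
    have "C [^] (- 2 * z * H0 * - k) = C [^] (2 * z * (j * k))"
      by (rule C_cong, rule dvdI[where k = "(j' - phi j) * k"])
         (simp add: H0_def algebra_simps eval_nat_numeral)
    moreover have "W (- (H0 - 2 * phi H0) * - k) = W ((j - 2 * phi j) * k)"
    proof (rule W_cong)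
      have "- (H0 - 2 * phi H0) * - k - (j - 2 * phi j) * k
        = 2 * z * ((j' - phi j) * (2 - 2 * j - 2 * z * (j' - phi j)) * k)"
        unfolding two_phi H0_def by (simp add: algebra_simps eval_nat_numeral)
      then show "2 * z dvd - (H0 - 2 * phi H0) * - k - (j - 2 * phi j) * k" by simp
    qed
    ultimately show ?thesis using B_mult_A_2z_pow[of H0 "- k"] by (simp add: X_def)
  qed
  have "nf i i' j j' k k' t \<otimes> A = A [^] I \<otimes> B [^] J \<otimes> (C [^] K \<otimes> A) \<otimes> W t"
    using W_comm(1)[of t 1] by (simp add: nf_def I_def J_def K_def m_assoc)
  also have "\<dots> = A [^] I \<otimes> (B [^] J \<otimes> A) \<otimes> X \<otimes> C [^] K \<otimes> W (k * (k + 1) - 2 * k') \<otimes> W t"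
    unfolding CA by (simp add: m_assoc)
  also have "\<dots> = A [^] I \<otimes> A \<otimes> B [^] H \<otimes> (C [^] (- J) \<otimes> X) \<otimes> C [^] K \<otimes> W (k * (k + 1) - 2 * k') \<otimes> W t"
    unfolding BA by (simp add: m_assoc)
  also have "\<dots> = A [^] I \<otimes> A \<otimes> (B [^] H0 \<otimes> X) \<otimes> C [^] (- J) \<otimes> C [^] K
      \<otimes> W v \<otimes> W (- 2 * k * j) \<otimes> W (k * (k + 1) - 2 * k') \<otimes> W t"
    unfolding CX BH by (simp add: m_assoc W_comm W_left_comm WX W_left_X)
  also have "\<dots> = (A [^] I \<otimes> A \<otimes> X) \<otimes> B [^] H0 \<otimes> (C [^] (2 * z * (j * k)) \<otimes> C [^] (- J) \<otimes> C [^] K)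
      \<otimes> (W ((j - 2 * phi j) * k) \<otimes> W v \<otimes> W (- 2 * k * j) \<otimes> W (k * (k + 1) - 2 * k') \<otimes> W t)"
    unfolding BX by (simp add: m_assoc W_comm W_left_comm)
  also have "A [^] I \<otimes> A \<otimes> X = A [^] (i + 1 + 2 * z * (i' - k))"
  proof -
    have "i + 1 + 2 * z * (i' - k) = I + 1 + 2 * z * - k" by (simp add: I_def algebra_simps)
    then show ?thesis by (simp only: int_pow_mult A X_def int_pow_1)
  qed
  also have "C [^] (2 * z * (j * k)) \<otimes> C [^] (- J) \<otimes> C [^] K = C [^] (k - j + 2 * z * (k' - j' + k * j))"
  proof -
    have "k - j + 2 * z * (k' - j' + k * j) = 2 * z * (j * k) + - J + K"
      by (simp add: J_def K_def algebra_simps)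
    then show ?thesis by (simp only: int_pow_mult C)
  qed
  also have "W ((j - 2 * phi j) * k) \<otimes> W v \<otimes> W (- 2 * k * j) \<otimes> W (k * (k + 1) - 2 * k') \<otimes> W t
    = W (t + k * (k + 1) - 2 * k' + (2 * j - 1) * j' - 2 * vphi (j + 1) - k * j - 2 * k * phi j)"
    unfolding W_add[symmetric] by (rule arg_cong[where f = W]) (simp add: v_def algebra_simps)
  finally show ?thesis by (simp add: nf_def H0_def)
qed

end

section \<open>The exponents as functions of \<open>n\<close>\<close>

text \<open>
  The recursions below are identities between polynomials with rational coefficients, so the
  integer divisions are replaced by rational ones before comparing coefficients.
\<close>
lemma phi_rat: "(of_int (phi n) :: rat) = of_int n * (of_int n - 1) / 2"
proof -
  have "(of_int (2 * phi n) :: rat) = of_int ((n - 1) * n)" by (simp only: two_phi)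
  then show ?thesis by (simp add: field_simps)
qed

lemma vphi_rat: "(of_int (vphi n) :: rat) = of_int n * (of_int n - 1) * (of_int n - 2) / 6"
proof -
  have "(of_int (6 * vphi n) :: rat) = of_int (n * (n - 1) * (n - 2))" by (simp only: six_vphi)
  then show ?thesis by (simp add: field_simps)
qed

lemma sigma1_rat:
  "(of_int (sigma1 k n) :: rat) = of_int k * of_int (phi n) * (of_int k * of_int (phi n) - 1) / 2"
proof -
  have "(of_int (2 * sigma1 k n) :: rat) = of_int (k * phi n * (k * phi n - 1))"
    by (simp only: two_sigma1)
  then show ?thesis by (simp add: field_simps)
qed

lemma sigma2_rat:
  "(of_int (sigma2 k n) :: rat) = of_int k * of_int (phi n) * ((of_int k)\<^sup>2 * of_int (phi n) - 1) / 6"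
proof -
  have "(of_int (6 * sigma2 k n) :: rat) = of_int (k * phi n * (k\<^sup>2 * phi n - 1))"
    by (simp only: six_sigma2)
  then show ?thesis by (simp add: field_simps)
qed

lemma sigma3_rat:
  "(of_int (sigma3 n) :: rat) =
    ((of_int n - 1) * of_int n * (6 * (of_int n - 1) ^ 3 + 9 * (of_int n - 1)\<^sup>2 + of_int n - 2) / 30
      - 3 * (of_int (phi n))\<^sup>2 + 4 * of_int (vphi n) + 2 * of_int (phi n)) / 6"
proof -
  define P where "P = (n - 1) * n * (6 * (n - 1) ^ 3 + 9 * (n - 1)\<^sup>2 + n - 2)"
  have "30 * (P div 30) = P"
    unfolding P_def by (rule dvd_mult_div_cancel[OF thirty_dvd_sigma3_inner])
  then have "(of_int (30 * (P div 30)) :: rat) = of_int P" by simp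
  then have "(of_int (P div 30) :: rat) = of_int P / 30" by (simp add: field_simps)
  moreover have "(of_int (6 * sigma3 n) :: rat)
      = of_int (P div 30 - 3 * (phi n)\<^sup>2 + 4 * vphi n + 2 * phi n)"
    by (simp only: six_sigma3 P_def)
  ultimately have "6 * (of_int (sigma3 n) :: rat)
      = of_int P / 30 - 3 * (of_int (phi n))\<^sup>2 + 4 * of_int (vphi n) + 2 * of_int (phi n)"
    by simp
  then have "(of_int (sigma3 n) :: rat)
      = (of_int P / 30 - 3 * (of_int (phi n))\<^sup>2 + 4 * of_int (vphi n) + 2 * of_int (phi n)) / 6"
    by simp
  then show ?thesis by (simp add: P_def)
qed

lemmas rat_forms = sigma1_rat sigma2_rat sigma3_rat vphi_rat phi_rat

text \<open>
  For \<open>(A\<^sup>a B\<^sup>b C\<^sup>c)\<^sup>n\<close>, the first three are the coefficients of \<open>2 * z\<close> in the exponents of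
  \<open>A\<close>, \<open>B\<close>, \<open>C\<close>, and \<open>expo_central\<close> is the exponent of the central factor \<open>W 1\<close>.
\<close>
definition expo_A :: "int \<Rightarrow> int \<Rightarrow> int \<Rightarrow> int \<Rightarrow> int" where
  "expo_A a b c n = a\<^sup>2 * b * vphi n + (phi a * b - a * c) * phi n"

definition expo_B :: "int \<Rightarrow> int \<Rightarrow> int \<Rightarrow> int \<Rightarrow> int" where
  "expo_B a b c n = (b * (c - a * b) - a * phi b) * phi n - 2 * a * b\<^sup>2 * vphi n"

definition expo_C :: "int \<Rightarrow> int \<Rightarrow> int \<Rightarrow> int \<Rightarrow> int" where
  "expo_C a b c n = a\<^sup>2 * phi b * vphi n + phi a * phi b * phi n - a\<^sup>2 * b\<^sup>2 * sigma2 1 n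
     - (phi a * b - a * c) * b * vphi (n + 1)"

definition expo_central :: "int \<Rightarrow> int \<Rightarrow> int \<Rightarrow> int \<Rightarrow> int" where
  "expo_central a b c n =
        a * (vphi b + 2 * phi b - 2 * phi c) * phi n
         + a\<^sup>2 * (3 * vphi b - 2 * b * phi b) * (2 * vphi n + phi n)
         + 2 * a * phi b * c * vphi n
         - 2 * a\<^sup>2 * b * phi b * (sigma1 1 n - vphi n)
         + (2 * b * c + 7 * phi b) * (a\<^sup>2 * vphi n + phi a * phi n)
         - 2 * phi b * (a + b) * (sigma1 a n - a * vphi n)
         - 2 * b * sigma2 a n
         + (2 * phi b - 2 * c - b) * (a\<^sup>2 * b * sigma2 1 n + (phi a * b - a * c) * vphi (n + 1))
         + 2 * b * (a * (phi a * b - a * c) + b\<^sup>2 * (phi a - a\<^sup>2)) * (sigma1 1 n + vphi (n + 1))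
         + 2 * a\<^sup>2 * b\<^sup>2 * (a - b) * (sigma3 n + sigma1 1 n - vphi n)
         - 2 * c * ((c - a * b) * b * vphi (n + 1) - 2 * a * b\<^sup>2 * sigma2 1 n)
         + 2 * b * (sigma1 (a * b) n + (phi (c + 1) - a * b * c) * phi n
                    - a * b * (2 * c + 1) * vphi n)"

lemma expo_A_step:
  "expo_A a b c (n + 1) = expo_A a b c n - (n * c - a * b * phi n) * a + n * b * phi a"
  (is "?l = ?r")
proof -
  have "(of_int ?l :: rat) = of_int ?r"
    unfolding expo_A_def of_int_add of_int_diff of_int_mult of_int_power
      of_int_1 of_int_numeral rat_forms
    by (simp add: field_simps eval_nat_numeral)
  then show ?thesis by (simp only: of_int_eq_iff)
qed

lemma expo_B_step:
  "expo_B a b c (n + 1) = expo_B a b c n - a * phi (n * b) + b * (n * c - a * b * phi n - a * (n * b))"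
  (is "?l = ?r")
proof -
  have "(of_int ?l :: rat) = of_int ?r"
    unfolding expo_B_def of_int_add of_int_diff of_int_mult of_int_power
      of_int_1 of_int_numeral rat_forms
    by (simp add: field_simps eval_nat_numeral)
  then show ?thesis by (simp only: of_int_eq_iff)
qed

lemma expo_C_step:
  "expo_C a b c (n + 1) = expo_C a b c n - a * expo_B a b c n + phi (n * b) * phi a
    + n * b * ((n * c - a * b * phi n) * a - n * b * phi a)"
  (is "?l = ?r")
proof -
  have "(of_int ?l :: rat) = of_int ?r"
    unfolding expo_C_def expo_B_def of_int_add of_int_diff of_int_mult of_int_power
      of_int_1 of_int_numeral rat_forms
    by (simp add: field_simps eval_nat_numeral)
  then show ?thesis by (simp only: of_int_eq_iff)
qed

text \<open>
  With \<open>j\<close> and \<open>k\<close> the exponents of \<open>B\<close> and \<open>C\<close> in the leading part, the terms up to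
  \<open>vphi (j + 1)\<close> are what \<open>nf_mult_A_pow\<close> below adds to the central exponent, and the last
  two are what \<open>nf_mult_B\<close> adds.
\<close>
lemma expo_central_step:
  fixes a b c n :: int
  defines "j \<equiv> n * b" and "k \<equiv> n * c - a * b * phi n"
  shows "expo_central a b c (n + 1) = expo_central a b c n
    + (k\<^sup>2 * a - 2 * k * j * phi a + j\<^sup>2 * (phi a + 2 * vphi a))
    + (1 - j - 2 * phi j) * (k * a - j * phi a)
    - 2 * (a * expo_C a b c n - phi a * expo_B a b c n + phi j * vphi a + j * k * phi a - j\<^sup>2 * vphi a)
    + (2 * j - 1) * (a * expo_B a b c n - phi a * phi j) - 2 * a * vphi (j + 1)
    - 2 * b * expo_C a b c (n + 1) - b * (k - a * j) * (k - a * j - 1)"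
  (is "?l = ?r")
proof -
  have "(of_int ?l :: rat) = of_int ?r"
    unfolding expo_central_def expo_B_def expo_C_def j_def k_def
      of_int_add of_int_diff of_int_mult of_int_power of_int_1 of_int_numeral rat_forms
    by (simp add: field_simps eval_nat_numeral)
  then show ?thesis by (simp only: of_int_eq_iff)
qed

lemma expo_A_0: "expo_A a b c 0 = 0"
  and expo_B_0: "expo_B a b c 0 = 0"
  and expo_C_0: "expo_C a b c 0 = 0"
  and expo_central_0: "expo_central a b c 0 = 0"
proof -
  have "phi 0 = 0" "vphi 0 = 0" "vphi 1 = 0" "sigma3 0 = 0" "\<And>k. sigma1 k 0 = 0" "\<And>k. sigma2 k 0 = 0"
    by (simp_all add: phi_def vphi_def sigma1_def sigma2_def sigma3_def)
  then show "expo_A a b c 0 = 0" "expo_B a b c 0 = 0" "expo_C a b c 0 = 0" "expo_central a b c 0 = 0"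
    by (simp_all add: expo_A_def expo_B_def expo_C_def expo_central_def)
qed

section \<open>The power formula\<close>

context macdonald begin

lemma nf_cong:
  assumes "i = i1" "i' = i1'" "j = j1" "j' = j1'" "k = k1" "k' = k1'" "t = t1"
  shows "nf i i' j j' k k' t = nf i1 i1' j1 j1' k1 k1' t1"
  using assms by simp

text \<open>
  The closed form sums the increments of \<open>nf_mult_A\<close> over \<open>a\<close> steps: the value of \<open>k\<close> after
  \<open>r\<close> steps is \<open>k - r * j\<close>, and over \<open>0 \<le> r < a\<close> the sum of \<open>r\<close> is \<open>phi a\<close> and the sum of
  \<open>r\<^sup>2\<close> is \<open>phi a + 2 * vphi a\<close>.
\<close>
lemma nf_mult_A_pow:
  "nf i i' j j' k k' t \<otimes> A [^] a
    = nf (i + a) (i' - k * a + j * phi a) j (j' - a * phi j) (k - a * j)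
       (k' - a * j' + phi j * phi a + j * (k * a - j * phi a))
       (t + (k\<^sup>2 * a - 2 * k * j * phi a + j\<^sup>2 * (phi a + 2 * vphi a))
          + (1 - j - 2 * phi j) * (k * a - j * phi a)
          - 2 * (a * k' - phi a * j' + phi j * vphi a + j * k * phi a - j\<^sup>2 * vphi a)
          + (2 * j - 1) * (a * j' - phi a * phi j) - 2 * a * vphi (j + 1))"
  (is "_ = ?f a")
proof -
  have "?f a = ?f 0 \<otimes> A [^] a"
  proof (rule int_pow_closed_form)
    fix a
    have "j\<^sup>2 * (2 * phi a) = j\<^sup>2 * ((a - 1) * a)" by (simp only: two_phi)
    then have "a * (a * (j * j)) = a * (j * j) + j * (j * (phi a * 2))"
      by (simp add: algebra_simps power2_eq_square)
    then show "?f (a + 1) = ?f a \<otimes> A"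
      unfolding nf_mult_A phi_add1[of a] vphi_add1[of a]
      by (intro nf_cong) (simp_all add: algebra_simps power2_eq_square)
  qed simp_all
  then show ?thesis by (simp add: phi_def vphi_def)
qed

theorem power_formula:
  "(A [^] a \<otimes> B [^] b \<otimes> C [^] c) [^] n
    = A [^] (n * a + 2 * z * expo_A a b c n) \<otimes> B [^] (n * b + 2 * z * expo_B a b c n)
      \<otimes> C [^] (n * c - a * b * phi n + 2 * z * expo_C a b c n)
      \<otimes> A [^] (2 * z\<^sup>2 * expo_central a b c n)"
proof -
  let ?f = "\<lambda>n. nf (n * a) (expo_A a b c n) (n * b) (expo_B a b c n)
      (n * c - a * b * phi n) (expo_C a b c n) (expo_central a b c n)"
  have "?f n = ?f 0 \<otimes> (A [^] a \<otimes> B [^] b \<otimes> C [^] c) [^] n"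
  proof (rule int_pow_closed_form)
    fix n
    have "?f n \<otimes> (A [^] a \<otimes> B [^] b \<otimes> C [^] c) = ?f n \<otimes> A [^] a \<otimes> B [^] b \<otimes> C [^] c"
      by (simp add: m_assoc)
    also have "\<dots> = ?f (n + 1)"
      unfolding nf_mult_A_pow nf_mult_B nf_mult_C
    proof (rule nf_cong)
      show "n * a + a = (n + 1) * a" "n * b + b = (n + 1) * b" by (simp_all add: distrib_right)
      show "n * c - a * b * phi n - a * (n * b) + c = (n + 1) * c - a * b * phi (n + 1)"
        unfolding phi_add1[of n] by (simp add: algebra_simps)
    qed (rule expo_A_step[symmetric] expo_B_step[symmetric] expo_C_step[symmetric]
        expo_central_step[of a b c n, unfolded expo_C_step, symmetric])+
    finally show "?f (n + 1) = ?f n \<otimes> (A [^] a \<otimes> B [^] b \<otimes> C [^] c)" by (simp only:)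
  qed simp_all
  moreover have "?f 0 = \<one>"
    by (simp add: nf_def expo_A_0 expo_B_0 expo_C_0 expo_central_0)
  ultimately have "?f n = (A [^] a \<otimes> B [^] b \<otimes> C [^] c) [^] n"
    by (simp only: l_one int_pow_closed m_closed A B C)
  then show ?thesis unfolding nf_def W_def by simp
qed

end

section \<open>The presented group\<close>

lemma word_class_int_pow:
  "word_class R (word_pow w k) = word_class R w [^]\<^bsub>presented_group R\<^esub> (k::int)"
proof -
  interpret group "presented_group R" by (rule group_presented_group)
  have nat: "word_class R (concat (replicate n w)) = word_class R w [^]\<^bsub>presented_group R\<^esub> n"
    for n :: nat and w
  proof (induction n)
    case (Suc n)
    have "word_class R (concat (replicate (Suc n) w))
        = word_class R w \<otimes>\<^bsub>presented_group R\<^esub> word_class R w [^]\<^bsub>presented_group R\<^esub> n"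
      by (simp add: Suc.IH[symmetric])
    also have "\<dots> = word_class R w [^]\<^bsub>presented_group R\<^esub> Suc n"
      by (rule nat_pow_Suc2[symmetric]) simp
    finally show ?case .
  qed simp
  show ?thesis
  proof (cases "0 \<le> k")
    case True
    then have "word_pow w k = concat (replicate (nat k) w)" by (simp add: word_pow_def)
    moreover have "word_class R w [^]\<^bsub>presented_group R\<^esub> k
        = word_class R w [^]\<^bsub>presented_group R\<^esub> nat k"
      using True by (simp add: int_pow_def2 del: pow_nat)
    ultimately show ?thesis by (simp only: nat)
  next
    case False
    then have "word_pow w k = concat (replicate (nat (- k)) (word_inv w))"
      by (simp add: word_pow_def)
    moreover have "word_class R w [^]\<^bsub>presented_group R\<^esub> k
        = (inv\<^bsub>presented_group R\<^esub> (word_class R w)) [^]\<^bsub>presented_group R\<^esub> nat (- k)"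
      using False by (simp add: int_pow_def2 nat_pow_inv del: pow_nat)
    ultimately show ?thesis by (simp only: nat inv_presented_group)
  qed
qed

lemma macdonald_J:
  assumes "1 \<le> m"
  shows "macdonald (J m l) (2 ^ (m - 1) * l) (2 ^ (3 * m - 1)) (J_A m l) (J_B m l)"
proof -
  interpret group "J m l" by (rule group_J)
  let ?R = "J_relations m l" and ?A = "[(GenA, True)]" and ?B = "[(GenB, True)]"
  obtain m' where m: "m = Suc m'" using assms by (cases m) auto
  have alpha: "alpha m l = 1 + 2 * (2 ^ (m - 1) * l)" by (simp add: alpha_def m)
  have cls: "word_class ?R v \<otimes>\<^bsub>J m l\<^esub> word_class ?R w = word_class ?R (v @ w)"
    "inv\<^bsub>J m l\<^esub> word_class ?R v = word_class ?R (word_inv v)"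
    "word_class ?R v [^]\<^bsub>J m l\<^esub> (k::int) = word_class ?R (word_pow v k)" for v w k
    by (simp_all add: J_def inv_presented_group word_class_int_pow)
  have rel: "word_class ?R v = word_class ?R w" if "(v, w) \<in> ?R" for v w
    unfolding word_class_eq_iff using that by (rule word_eq.rel)
  have mem: "(word_conj ?A (word_comm ?A ?B), word_pow ?A (alpha m l)) \<in> ?R"
    "(word_conj ?B (word_comm ?B ?A), word_pow ?B (alpha m l)) \<in> ?R"
    "(word_pow ?A (2 ^ (3 * m - 1)), []) \<in> ?R"
    "(word_pow ?B (2 ^ (3 * m - 1)), []) \<in> ?R"
    by (simp_all only: J_relations_def Let_def insert_iff simp_thms)
  note rel_A = rel[OF mem(1)] and rel_B = rel[OF mem(2)]
    and A_order = rel[OF mem(3)] and B_order = rel[OF mem(4)]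
  have one: "\<one>\<^bsub>J m l\<^esub> = word_class ?R []" by (simp add: J_def)
  show ?thesis
  proof
    show "(2::int) ^ (3 * m - 1) dvd 4 * (2 ^ (m - 1) * l) ^ 3"
    proof -
      have e: "3 * m - 1 = (m - 1) * 3 + 2" by (simp add: m)
      have "4 * (2 ^ (m - 1) * l) ^ 3 = 2 ^ (3 * m - 1) * l ^ 3"
        unfolding e power_add power_mult power_mult_distrib by simp
      then show ?thesis by simp
    qed
    show "coprime ((2::int) ^ (3 * m - 1)) 3"
      by (simp only: coprime_power_left_iff coprime_left_2_iff_odd) simp
    show "J_A m l \<in> carrier (J m l)" "J_B m l \<in> carrier (J m l)"
      by (simp_all add: J_A_def J_B_def J_def)
    show "J_A m l [^]\<^bsub>J m l\<^esub> ((2::int) ^ (3 * m - 1)) = \<one>\<^bsub>J m l\<^esub>"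
      "J_B m l [^]\<^bsub>J m l\<^esub> ((2::int) ^ (3 * m - 1)) = \<one>\<^bsub>J m l\<^esub>"
      unfolding J_A_def J_B_def cls one by (rule A_order, rule B_order)
    show "conj_by (inv\<^bsub>J m l\<^esub> J_A m l \<otimes>\<^bsub>J m l\<^esub> inv\<^bsub>J m l\<^esub> J_B m l \<otimes>\<^bsub>J m l\<^esub> J_A m l \<otimes>\<^bsub>J m l\<^esub> J_B m l) (J_A m l)
        = J_A m l [^]\<^bsub>J m l\<^esub> (1 + 2 * (2 ^ (m - 1) * l))"
      using rel_A
      unfolding alpha[symmetric] J_A_def J_B_def conj_by_def cls word_conj_def word_comm_def
      by (simp add: word_inv_def)
    show "conj_by (inv\<^bsub>J m l\<^esub> (inv\<^bsub>J m l\<^esub> J_A m l \<otimes>\<^bsub>J m l\<^esub> inv\<^bsub>J m l\<^esub> J_B m l \<otimes>\<^bsub>J m l\<^esub> J_A m l \<otimes>\<^bsub>J m l\<^esub> J_B m l)) (J_B m l)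
        = J_B m l [^]\<^bsub>J m l\<^esub> (1 + 2 * (2 ^ (m - 1) * l))"
      using rel_B
      unfolding alpha[symmetric] J_A_def J_B_def conj_by_def cls word_conj_def word_comm_def
      by (simp add: word_inv_def)
  qed
qed

theorem theorem3p5:
  fixes m :: nat and l a b c n s u eA eB eC xi4 :: int
  assumes "1 \<le> m" and "odd l"
    and s: "s = 2 ^ (m - 1)" and u: "u = s\<^sup>2"
    and eA: "eA = n * a + 2 * s * l * (a\<^sup>2 * b * vphi n + (phi a * b - a * c) * phi n)"
    and eB: "eB = n * b + 2 * s * l * ((b * (c - a * b) - a * phi b) * phi n
                    - 2 * a * b\<^sup>2 * vphi n)"
    and eC: "eC = n * c - a * b * phi n
                  + 2 * s * l * (a\<^sup>2 * phi b * vphi n + phi a * phi b * phi n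
                    - a\<^sup>2 * b\<^sup>2 * sigma2 1 n
                    - (phi a * b - a * c) * b * vphi (n + 1))"
    and xi4: "xi4 = 2 * u * l\<^sup>2 *
        (a * (vphi b + 2 * phi b - 2 * phi c) * phi n
         + a\<^sup>2 * (3 * vphi b - 2 * b * phi b) * (2 * vphi n + phi n)
         + 2 * a * phi b * c * vphi n
         - 2 * a\<^sup>2 * b * phi b * (sigma1 1 n - vphi n)
         + (2 * b * c + 7 * phi b) * (a\<^sup>2 * vphi n + phi a * phi n)
         - 2 * phi b * (a + b) * (sigma1 a n - a * vphi n)
         - 2 * b * sigma2 a n
         + (2 * phi b - 2 * c - b) * (a\<^sup>2 * b * sigma2 1 n + (phi a * b - a * c) * vphi (n + 1))
         + 2 * b * (a * (phi a * b - a * c) + b\<^sup>2 * (phi a - a\<^sup>2)) * (sigma1 1 n + vphi (n + 1))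
         + 2 * a\<^sup>2 * b\<^sup>2 * (a - b) * (sigma3 n + sigma1 1 n - vphi n)
         - 2 * c * ((c - a * b) * b * vphi (n + 1) - 2 * a * b\<^sup>2 * sigma2 1 n)
         + 2 * b * (sigma1 (a * b) n + (phi (c + 1) - a * b * c) * phi n
                    - a * b * (2 * c + 1) * vphi n))"
  shows "(J_A m l [^]\<^bsub>J m l\<^esub> a \<otimes>\<^bsub>J m l\<^esub> J_B m l [^]\<^bsub>J m l\<^esub> b \<otimes>\<^bsub>J m l\<^esub> J_C m l [^]\<^bsub>J m l\<^esub> c) [^]\<^bsub>J m l\<^esub> n
       = J_A m l [^]\<^bsub>J m l\<^esub> eA \<otimes>\<^bsub>J m l\<^esub> J_B m l [^]\<^bsub>J m l\<^esub> eB \<otimes>\<^bsub>J m l\<^esub> J_C m l [^]\<^bsub>J m l\<^esub> eC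
           \<otimes>\<^bsub>J m l\<^esub> J_A m l [^]\<^bsub>J m l\<^esub> xi4"
proof -
  define z where "z = 2 ^ (m - 1) * l"
  interpret macdonald "J m l" z "2 ^ (3 * m - 1)" "J_A m l" "J_B m l"
    unfolding z_def using \<open>1 \<le> m\<close> by (rule macdonald_J)
  have "C = J_C m l" by (simp only: C_def J_C_def)
  moreover have "2 * s * l = 2 * z" and "2 * u * l\<^sup>2 = 2 * z\<^sup>2"
    by (simp_all add: z_def s u power_mult_distrib)
  ultimately show ?thesis
    using power_formula[of a b c n]
    by (simp only: eA eB eC xi4 expo_A_def expo_B_def expo_C_def expo_central_def)
qed

end
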